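(* Let $X=(0,1)$ and let $K:X\times X\to\mathbb{R}$ be the covariance of Brownian motion, $K(x,y)=\min\{x,y\}$ for $x,y\in(0,1)$. Then $K$ is an admissible single-task kernel and satisfies the Lebesgue constant condition: for all $m\in\mathbb{N}$ and all pairwise distinct points $\mathbf{x}=\{x_j:j\in\mathbb{N}_m\}\subseteq(0,1)$, $$\sup_{t\in(0,1)}\|K[\mathbf{x}]^{-1}K_{\mathbf{x}}(t)\|_1\le1.$$
   Context: $\mathbb{N}=\{1,2,\dots\}$, $\mathbb{N}_m=\{1,\dots,m\}$, and $\|\cdot\|_1$ is the $\ell^1$ norm of vectors. For distinct points $\mathbf{x}=\{x_1,\dots,x_m\}$, $K[\mathbf{x}]\in\mathbb{R}^{m\times m}$ is the matrix with $(j,k)$ entry $K(x_k,x_j)$, and $K_{\mathbf{x}}(t)=(K(t,x_j):j\in\mathbb{N}_m)^\top\in\mathbb{R}^m$. $K:X\times X\to\mathbb{R}$ is an admissible single-task kernel if (A1) $K[\mathbf{x}]$ is non-singular for all $m\in\mathbb{N}$ and all pairwise distinct $x_1,\dots,x_m\in X$; (A2) there is $\kappa>0$ with $|K(x,x')|\le\kappa$ for all $x,x'\in X$; (A3) for all pairwise distinct $x_j\in X$, $j\in\mathbb{N}$, and real sequences $(c_j)_{j\in\mathbb{N}}$ with $\sum_j|c_j|<\infty$, if $\sum_{j\in\mathbb{N}}K(x_j,x)c_j=0$ for all $x\in X$, then $c_j=0$ for all $j$. *)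

theory Defs
  imports
    Complex_Main
    "HOL-Library.Extended_Real"
    "Jordan_Normal_Form.Gauss_Jordan_Elimination"
begin

text \<open>
  A kernel on \<open>X\<close> is a function of type \<open>'a \<Rightarrow> 'a \<Rightarrow> real\<close> of which only the values on \<open>X \<times> X\<close>
  are used. Points \<open>x\<^sub>1, \<dots>, x\<^sub>m\<close> are given by \<open>x :: nat \<Rightarrow> 'a\<close> on \<open>{..<m}\<close>, so indices start at 0.
\<close>

definition distinct_points :: "'a set \<Rightarrow> nat \<Rightarrow> (nat \<Rightarrow> 'a) \<Rightarrow> bool" where
  "distinct_points X m x \<longleftrightarrow> x ` {..<m} \<subseteq> X \<and> inj_on x {..<m}"

text \<open>The index order is transposed: the \<open>(j, k)\<close> entry is \<open>K(x\<^sub>k, x\<^sub>j)\<close>.\<close>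

definition kernel_mat :: "('a \<Rightarrow> 'a \<Rightarrow> real) \<Rightarrow> nat \<Rightarrow> (nat \<Rightarrow> 'a) \<Rightarrow> real mat" where
  "kernel_mat K m x = mat m m (\<lambda>(j, k). K (x k) (x j))"

definition kernel_vec :: "('a \<Rightarrow> 'a \<Rightarrow> real) \<Rightarrow> nat \<Rightarrow> (nat \<Rightarrow> 'a) \<Rightarrow> 'a \<Rightarrow> real vec" where
  "kernel_vec K m x t = vec m (\<lambda>j. K t (x j))"

definition l1_norm_vec :: "real vec \<Rightarrow> real" where
  "l1_norm_vec v = (\<Sum>i<dim_vec v. \<bar>v $ i\<bar>)"

text \<open>In the third condition, \<open>sums 0\<close> asserts convergence of the series as well as its value.\<close>

definition admissible_kernel :: "'a set \<Rightarrow> ('a \<Rightarrow> 'a \<Rightarrow> real) \<Rightarrow> bool" where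
  "admissible_kernel X K \<longleftrightarrow>
     (\<forall>m\<ge>1. \<forall>x. distinct_points X m x \<longrightarrow> invertible_mat (kernel_mat K m x)) \<and>
     (\<exists>\<kappa>>0. \<forall>x\<in>X. \<forall>x'\<in>X. \<bar>K x x'\<bar> \<le> \<kappa>) \<and>
     (\<forall>(x :: nat \<Rightarrow> 'a) (c :: nat \<Rightarrow> real).
        range x \<subseteq> X \<longrightarrow> inj x \<longrightarrow> summable (\<lambda>j. \<bar>c j\<bar>) \<longrightarrow>
        (\<forall>t\<in>X. (\<lambda>j. K (x j) t * c j) sums 0) \<longrightarrow> (\<forall>j. c j = 0))"

text \<open>
  The supremum is taken in the extended reals, so that a bound on it is meaningful without
  knowing boundedness beforehand. The library function \<open>mat_inverse\<close> returns
  \<open>Some\<close> of the inverse exactly for invertible square matrices; \<open>the (mat_inverse A)\<close> is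
  the inverse of \<open>A\<close> in that case and unspecified otherwise.
\<close>

definition lebesgue_constant ::
    "'a set \<Rightarrow> ('a \<Rightarrow> 'a \<Rightarrow> real) \<Rightarrow> nat \<Rightarrow> (nat \<Rightarrow> 'a) \<Rightarrow> ereal" where
  "lebesgue_constant X K m x =
     (SUP t\<in>X. ereal (l1_norm_vec (the (mat_inverse (kernel_mat K m x)) *\<^sub>v kernel_vec K m x t)))"

end

theory Submission
  imports Defs "Jordan_Normal_Form.Determinant"
begin

text \<open>
  As a function of \<open>t\<close>, \<open>min t y\<close> is affine on every interval that does not contain \<open>y\<close> in its
  interior. So if \<open>x\<^sub>a \<le> t < x\<^sub>b\<close> are neighbouring nodes, \<open>K\<^sub>x(t)\<close> is the convex combination of
  the columns \<open>K\<^sub>x(x\<^sub>a)\<close> and \<open>K\<^sub>x(x\<^sub>b)\<close>; beyond the last node it is the last column, and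
  before the first node \<open>x\<^sub>a\<close> it is \<open>t / x\<^sub>a \<le> 1\<close> times the first one. These coefficients are
  the vector \<open>K[x]\<inverse> K\<^sub>x(t)\<close>. Non-singularity and (A3) hold because second differences of
  \<open>t \<mapsto> min y t\<close> are tent functions: shrinking the tent around \<open>x\<^sub>i\<close> isolates \<open>c\<^sub>i\<close>.
\<close>

section \<open>Interpolation weights between neighbouring nodes\<close>

lemma min_interpolation_weights:
  fixes x :: "'i \<Rightarrow> real"
  assumes "finite I" "I \<noteq> {}" and pos: "\<And>i. i \<in> I \<Longrightarrow> 0 < x i" and "0 < t"
  obtains w where "\<And>y. y \<in> x ` I \<Longrightarrow> min t y = (\<Sum>i\<in>I. w i * min (x i) y)"
    and "(\<Sum>i\<in>I. \<bar>w i\<bar>) \<le> 1"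
proof -
  note weights = that
  \<comment> \<open>Serves the two cases where all nodes lie on one side of \<open>t\<close>: the
    whole weight sits on one extreme node.\<close>
  have single: thesis if "a \<in> I" "0 \<le> p" "p \<le> 1" "\<And>j. j \<in> I \<Longrightarrow> min t (x j) = p * min (x a) (x j)"
    for a p
  proof (rule weights[of "\<lambda>i. if i = a then p else 0"])
  qed (use that assms(1) in \<open>auto simp: if_distrib[of "\<lambda>z. z * _"] if_distrib[of abs] cong: if_cong\<close>)
  let ?L = "{i \<in> I. x i \<le> t}" and ?R = "{i \<in> I. t < x i}"
  have fin: "finite ?L" "finite ?R"
    using assms(1) by auto
  consider "?L = {}" | "?R = {}" | "?L \<noteq> {}" "?R \<noteq> {}"
    by blast
  then show thesis
  proof cases
    case 1
    obtain a where a: "a \<in> I" "\<And>i. i \<in> I \<Longrightarrow> x a \<le> x i"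
      using ex_min_if_finite[of "x ` I"] assms(1,2) by (auto simp: not_less)
    have "t < x a"
      using 1 a(1) by auto
    moreover have "min t (x j) = t / x a * min (x a) (x j)" if "j \<in> I" for j
      using pos[OF a(1)] \<open>t < x a\<close> a(2)[OF that] by (simp add: min_def)
    ultimately show thesis
      using \<open>0 < t\<close> a(1) by (intro single[of a "t / x a"]) auto
  next
    case 2
    \<comment> \<open>Minimising the negated nodes yields the largest one.\<close>
    obtain a where a: "a \<in> I" "\<And>i. i \<in> I \<Longrightarrow> x i \<le> x a"
      using ex_min_if_finite[of "(\<lambda>i. - x i) ` I"] assms(1,2) by (auto simp: not_less)
    have "min t (x j) = 1 * min (x a) (x j)" if "j \<in> I" for j
      using 2 a(2)[OF that] that by (auto simp: min_def not_less)
    then show thesis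
      using a(1) by (intro single[of a 1]) auto
  next
    case 3
    obtain a where a: "a \<in> I" "x a \<le> t" "\<And>i. i \<in> I \<Longrightarrow> x i \<le> t \<Longrightarrow> x i \<le> x a"
      using ex_min_if_finite[of "(\<lambda>i. - x i) ` ?L"] 3(1) fin(1) by (auto simp: not_less)
    obtain b where b: "b \<in> I" "t < x b" "\<And>i. i \<in> I \<Longrightarrow> t < x i \<Longrightarrow> x b \<le> x i"
      using ex_min_if_finite[of "x ` ?R"] 3(2) fin(2) by (auto simp: not_less) (metis not_le)
    have ab: "x a < x b" "a \<noteq> b"
      using a b by auto
    \<comment> \<open>The barycentric coordinate of \<open>t\<close> between the two neighbours, so
      that \<open>t = p * x a + (1 - p) * x b\<close>.\<close>
    define p where "p = (x b - t) / (x b - x a)"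
    have p: "0 \<le> p" "p \<le> 1"
      using a b ab by (auto simp: p_def field_simps)
    have "p * (x b - x a) = x b - t"
      using ab by (simp add: p_def)
    then have t: "t = p * x a + (1 - p) * x b"
      by (simp add: algebra_simps)
    have sum: "(\<Sum>i\<in>I. (if i = a then u else if i = b then v else 0) * f i) = u * f a + v * f b"
      for u v :: real and f
    proof -
      have "(\<Sum>i\<in>I. (if i = a then u else if i = b then v else 0) * f i)
          = (\<Sum>i\<in>I. (if i = a then u * f i else 0) + (if i = b then v * f i else 0))"
        using ab by (intro sum.cong) auto
      then show ?thesis
        using a(1) b(1) assms(1) by (simp add: sum.distrib)
    qed
    let ?w = "\<lambda>i. if i = a then p else if i = b then 1 - p else 0"
    show thesis
    proof (rule weights[of ?w])
      fix y
      assume "y \<in> x ` I"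
      then obtain j where j: "j \<in> I" "y = x j"
        by auto
      \<comment> \<open>No node lies strictly between \<open>x a\<close> and \<open>x b\<close>. For
        \<open>y \<le> x a\<close> all three minima equal \<open>y\<close>; for
        \<open>y \<ge> x b\<close> they are \<open>t\<close>, \<open>x a\<close> and
        \<open>x b\<close>, and the claim is the formula for \<open>t\<close>.\<close>
      have "min t y = p * min (x a) y + (1 - p) * min (x b) y"
      proof (cases "y \<le> t")
        case True
        then have "y \<le> x a"
          using a j by auto
        then show ?thesis
          using True ab by (simp add: min_def algebra_simps)
      next
        case False
        then have "x b \<le> y"
          using b j by auto
        then show ?thesis
          using False ab t by (simp add: min_def)
      qed
      then show "min t y = (\<Sum>i\<in>I. ?w i * min (x i) y)"
        by (simp only: sum)
    next
      \<comment> \<open>The weights are nonnegative; the factor 1 lets \<open>sum\<close> apply with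
        a constant \<open>f\<close>.\<close>
      have "(\<Sum>i\<in>I. \<bar>?w i\<bar>) = (\<Sum>i\<in>I. ?w i * 1)"
        using p by (intro sum.cong) auto
      then show "(\<Sum>i\<in>I. \<bar>?w i\<bar>) \<le> 1"
        by (simp only: sum) simp
    qed
  qed
qed

section \<open>Recovering coefficients with tent functions\<close>

text \<open>Evaluating the series at \<open>x i\<close> and \<open>x i \<plusminus> h\<close>
  replaces each section of \<open>min\<close> by a tent centred at \<open>x i\<close>; a narrow tent
  leaves \<open>c i\<close> and a small tail. Distinctness is asked only where
  \<open>c j \<noteq> 0\<close>, so that the lemma also covers finite families padded with zero
  coefficients.\<close>

lemma min_series_eq_0_imp_coeff_eq_0:
  fixes x c :: "nat \<Rightarrow> real"
  assumes summ: "summable (\<lambda>j. \<bar>c j\<bar>)"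
    and zero: "\<And>t. t \<in> {u<..<v} \<Longrightarrow> (\<lambda>j. min (x j) t * c j) sums 0"
    and i: "x i \<in> {u<..<v}"
    and dist: "\<And>j. j \<noteq> i \<Longrightarrow> c j \<noteq> 0 \<Longrightarrow> x j \<noteq> x i"
  shows "c i = 0"
proof -
  define tent where "tent h y = max 0 (1 - \<bar>y - x i\<bar> / h)" for h y
  have tent_01: "0 \<le> tent h y" "tent h y \<le> 1" if "0 < h" for h y
    using that by (auto simp: tent_def)
  have tent_sums: "(\<lambda>j. tent h (x j) * c j) sums 0"
    if h: "0 < h" "x i - h \<in> {u<..<v}" "x i + h \<in> {u<..<v}" for h
  proof -
    \<comment> \<open>A negated second difference with step \<open>h\<close>; dividing by
      \<open>h\<close> gives the tent height 1.\<close>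
    have "(\<lambda>j. (2 * (min (x j) (x i) * c j) - min (x j) (x i - h) * c j
              - min (x j) (x i + h) * c j) / h) sums ((2 * 0 - 0 - 0) / h)"
      by (intro sums_divide sums_diff sums_mult zero i h)
    moreover have "(2 * (min (x j) (x i) * c j) - min (x j) (x i - h) * c j
              - min (x j) (x i + h) * c j) / h = tent h (x j) * c j" for j
    proof -
      have "2 * min (x j) (x i) - min (x j) (x i - h) - min (x j) (x i + h) = h * tent h (x j)"
        using h(1) by (auto simp: tent_def min_def max_def abs_if field_simps)
      then have "(2 * (min (x j) (x i) * c j) - min (x j) (x i - h) * c j
              - min (x j) (x i + h) * c j) = h * tent h (x j) * c j"
        by (metis (no_types, lifting) left_diff_distrib mult.assoc)
      then show ?thesis
        using h(1) by simp
    qed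
    ultimately show ?thesis
      by simp
  qed
  have "\<bar>c i\<bar> \<le> e" if e: "0 < e" for e
  proof -
    obtain N where N: "(\<Sum>j. \<bar>c (j + N)\<bar>) < e"
      using suminf_exist_split[OF e summ]
      by (metis order.refl real_norm_def abs_ge_self order_le_less_trans)
    define J where "J = {j. j < N \<and> j \<noteq> i \<and> c j \<noteq> 0}"
    \<comment> \<open>The distances that \<open>h\<close> must stay below: to the endpoints, keeping
      \<open>x i \<plusminus> h\<close> in the interval, and to the finitely many other nodes with
      index below \<open>N\<close> and nonzero coefficient, keeping them off the tent.\<close>
    define D where "D = insert (x i - u) (insert (v - x i) ((\<lambda>j. \<bar>x j - x i\<bar>) ` J))"
    have D: "finite D" "D \<noteq> {}" "\<And>d. d \<in> D \<Longrightarrow> 0 < d"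
      using i dist by (auto simp: D_def J_def)
    define h where "h = Min D / 2"
    have h: "0 < h" "\<And>d. d \<in> D \<Longrightarrow> h < d"
    proof -
      have M: "0 < Min D"
        using D by simp
      then show "0 < h"
        by (simp add: h_def)
      show "h < d" if "d \<in> D" for d
        using Min_le[OF D(1) that] M by (simp add: h_def)
    qed
    have near: "h < x i - u" "h < v - x i" and far: "\<And>j. j \<in> J \<Longrightarrow> h < \<bar>x j - x i\<bar>"
      by (rule h(2), simp add: D_def)+
    define g where "g j = tent h (x j) * c j" for j
    have g: "g sums 0"
      unfolding g_def using near h(1) i by (intro tent_sums) auto
    have g0: "g j = 0" if "j < N" "j \<noteq> i" for j
    proof (cases "c j = 0")
      case False
      then show ?thesis
        using far[of j] that h(1) by (auto simp: J_def g_def tent_def field_simps)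
    qed (simp add: g_def)
    have g_le: "\<bar>g j\<bar> \<le> \<bar>c j\<bar>" for j
      using tent_01[OF h(1), of "x j"] by (simp add: g_def abs_mult mult_left_le_one_le)
    have gi: "g i = c i"
      using h(1) by (simp add: g_def tent_def)
    have summ': "summable (\<lambda>j. \<bar>c (j + N)\<bar>)"
      using summ by (subst summable_iff_shift)
    have tail: "(\<lambda>j. g (j + N)) sums (0 - (\<Sum>j<N. g j))"
      using g by (simp add: sums_iff_shift)
    \<comment> \<open>If \<open>i < N\<close>, the head of the tent series is \<open>c i\<close>
      alone, so the tail sums to \<open>- c i\<close>. Otherwise \<open>c i\<close> is itself a term
      of the tail of \<open>c\<close>. Either way the tail bound \<open>e\<close> applies.\<close>
    show ?thesis
    proof (cases "i < N")
      case True
      have "(\<Sum>j<N. g j) = (\<Sum>j<N. if j = i then c i else 0)"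
        using g0 gi by (intro sum.cong) auto
      then have "\<bar>c i\<bar> = \<bar>\<Sum>j. g (j + N)\<bar>"
        using tail True by (simp add: sums_iff)
      also have "\<dots> \<le> (\<Sum>j. \<bar>g (j + N)\<bar>)"
        by (intro summable_rabs summable_comparison_test'[OF summ', of 0]) (simp add: g_le)
      also have "\<dots> \<le> (\<Sum>j. \<bar>c (j + N)\<bar>)"
        by (intro suminf_le g_le summ' summable_comparison_test'[OF summ', of 0]) (simp add: g_le)
      finally show ?thesis
        using N by simp
    next
      case False
      then have "\<bar>c i\<bar> = (\<Sum>j\<in>{i - N}. \<bar>c (j + N)\<bar>)"
        by simp
      also have "\<dots> \<le> (\<Sum>j. \<bar>c (j + N)\<bar>)"
        by (intro sum_le_suminf summ') auto
      finally show ?thesis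
        using N by simp
    qed
  qed
  then show ?thesis
    by (metis abs_le_zero_iff field_le_epsilon add_0)
qed

section \<open>Non-singularity and the Lebesgue constant\<close>

lemma Units_imp_mat_inverse:
  fixes A :: "'a :: field mat"
  assumes "A \<in> carrier_mat n n" "A \<in> Units (ring_mat TYPE('a) n b)"
  obtains B where "mat_inverse A = Some B" "B \<in> carrier_mat n n" "A * B = 1\<^sub>m n" "B * A = 1\<^sub>m n"
  using assms mat_inverse(1)[OF assms(1), of b] mat_inverse(2)[OF assms(1)]
  by (cases "mat_inverse A") auto

text \<open>A null vector of the matrix gives a combination of kernel sections vanishing at the
  nodes. By interpolation it vanishes on all of (0,1), hence has zero coefficients.\<close>

lemma kernel_mat_min_Units:
  fixes x :: "nat \<Rightarrow> real"
  assumes "m \<ge> 1" "distinct_points {0<..<1} m x"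
  shows "kernel_mat min m x \<in> Units (ring_mat TYPE(real) m b)"
proof (rule det_non_zero_imp_unit)
  let ?A = "kernel_mat min m x"
  show A: "?A \<in> carrier_mat m m"
    by (simp add: kernel_mat_def)
  have x: "0 < x j" "x j < 1" if "j < m" for j
    using assms(2) that by (auto simp: distinct_points_def)
  have inj: "inj_on x {..<m}"
    using assms(2) by (simp add: distinct_points_def)
  show "det ?A \<noteq> 0"
  proof
    assume "det ?A = 0"
    then obtain v where v: "v \<in> carrier_vec m" "v \<noteq> 0\<^sub>v m" "?A *\<^sub>v v = 0\<^sub>v m"
      using det_0_iff_vec_prod_zero_field[OF A] by blast
    \<comment> \<open>Padding with zeros turns the finite sum into a series; \<open>x\<close> is
      arbitrary from index \<open>m\<close> on.\<close>
    define c where "c j = (if j < m then v $ j else 0)" for j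
    have nodes: "(\<Sum>k<m. min (x k) (x j) * c k) = 0" if "j < m" for j
    proof -
      have "(?A *\<^sub>v v) $ j = 0"
        using v(3) that by simp
      then show ?thesis
        using that v(1) by (simp add: kernel_mat_def scalar_prod_def c_def lessThan_atLeast0)
    qed
    have zero: "(\<lambda>k. min (x k) t * c k) sums 0" if "t \<in> {0<..<1}" for t
    proof -
      obtain w where w: "\<And>y. y \<in> x ` {..<m} \<Longrightarrow> min t y = (\<Sum>i<m. w i * min (x i) y)"
        by (rule min_interpolation_weights[of "{..<m}" x t])
          (use x assms(1) \<open>t \<in> {0<..<1}\<close> in \<open>auto simp: lessThan_empty_iff\<close>)
      have "(\<Sum>k<m. min (x k) t * c k) = (\<Sum>k<m. \<Sum>i<m. w i * (min (x k) (x i) * c k))"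
        using w by (intro sum.cong) (simp_all add: min.commute[of _ t] min.commute[of "x _" "x _"]
            sum_distrib_left mult_ac)
      also have "\<dots> = (\<Sum>i<m. w i * (\<Sum>k<m. min (x k) (x i) * c k))"
        by (subst sum.swap) (simp add: sum_distrib_left)
      also have "\<dots> = 0"
        using nodes by simp
      finally show ?thesis
        using sums_finite[of "{..<m}" "\<lambda>k. min (x k) t * c k"] by (simp add: c_def)
    qed
    have "c i = 0" if "i < m" for i
    proof (rule min_series_eq_0_imp_coeff_eq_0[OF _ zero])
      show "summable (\<lambda>j. \<bar>c j\<bar>)"
        by (rule summable_finite[of "{..<m}"]) (auto simp: c_def)
      show "x j \<noteq> x i" if "j \<noteq> i" "c j \<noteq> 0" for j
        using that \<open>i < m\<close> inj by (auto simp: c_def inj_on_def split: if_splits)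
    qed (use that x in auto)
    then have "v = 0\<^sub>v m"
      using v(1) by (intro eq_vecI) (auto simp: c_def)
    then show False
      using v(2) by simp
  qed
qed

lemma lebesgue_constant_min_le_1:
  fixes x :: "nat \<Rightarrow> real"
  assumes "m \<ge> 1" "distinct_points {0<..<1} m x"
  shows "lebesgue_constant {0<..<1} min m x \<le> 1"
  unfolding lebesgue_constant_def
proof (rule SUP_least)
  fix t :: real
  assume t: "t \<in> {0<..<1}"
  let ?A = "kernel_mat min m x"
  have A: "?A \<in> carrier_mat m m"
    by (simp add: kernel_mat_def)
  obtain B where B: "mat_inverse ?A = Some B" "B \<in> carrier_mat m m" "B * ?A = 1\<^sub>m m"
    by (rule Units_imp_mat_inverse[OF A kernel_mat_min_Units[OF assms]])
  have x: "0 < x j" if "j < m" for j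
    using assms(2) that by (auto simp: distinct_points_def)
  obtain w where w: "\<And>y. y \<in> x ` {..<m} \<Longrightarrow> min t y = (\<Sum>i<m. w i * min (x i) y)"
    and norm_w: "(\<Sum>i<m. \<bar>w i\<bar>) \<le> 1"
    by (rule min_interpolation_weights[of "{..<m}" x t])
      (use x assms(1) t in \<open>auto simp: lessThan_empty_iff\<close>)
  \<comment> \<open>The interpolation identity at \<open>y = x j\<close> is row \<open>j\<close> of
    this linear system, so the inverse returns exactly the weights and their norm bound carries
    over.\<close>
  have "kernel_vec min m x t = ?A *\<^sub>v vec m w"
    using w by (intro eq_vecI)
      (auto simp: kernel_vec_def kernel_mat_def scalar_prod_def lessThan_atLeast0 mult.commute)
  then have "B *\<^sub>v kernel_vec min m x t = vec m w"
    using A B by (simp flip: assoc_mult_mat_vec[of B m m ?A m])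
  then show "ereal (l1_norm_vec (the (mat_inverse ?A) *\<^sub>v kernel_vec min m x t)) \<le> 1"
    using norm_w B(1) by (simp add: l1_norm_vec_def)
qed

lemma admissible_kernel_min: "admissible_kernel {0<..<1} (min :: real \<Rightarrow> real \<Rightarrow> real)"
  unfolding admissible_kernel_def
proof (intro conjI allI impI)
  fix m :: nat and x :: "nat \<Rightarrow> real"
  assume mx: "m \<ge> 1" "distinct_points {0<..<1} m x"
  have A: "kernel_mat min m x \<in> carrier_mat m m"
    by (simp add: kernel_mat_def)
  obtain B where "B \<in> carrier_mat m m" "kernel_mat min m x * B = 1\<^sub>m m"
    "B * kernel_mat min m x = 1\<^sub>m m"
    by (rule Units_imp_mat_inverse[OF A kernel_mat_min_Units[OF mx]])
  then show "invertible_mat (kernel_mat min m x)"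
    using A by (auto simp: invertible_mat_def inverts_mat_def)
next
  show "\<exists>\<kappa>>0. \<forall>x\<in>{0<..<1}. \<forall>x'\<in>{0<..<1}. \<bar>min x x' :: real\<bar> \<le> \<kappa>"
    by (rule exI[of _ 1]) auto
next
  fix x c :: "nat \<Rightarrow> real" and i
  assume "range x \<subseteq> {0<..<1}" "inj x" "summable (\<lambda>j. \<bar>c j\<bar>)"
    and "\<forall>t\<in>{0<..<1}. (\<lambda>j. min (x j) t * c j) sums 0"
  then show "c i = 0"
    by (intro min_series_eq_0_imp_coeff_eq_0[of c 0 1 x]) (auto simp: image_subset_iff dest: injD)
qed

section \<open>Transfer to kernels that agree with \<open>min\<close> on
  \<open>X \<times> X\<close>\<close>

lemma kernel_mat_cong:
  assumes "\<And>s t. s \<in> X \<Longrightarrow> t \<in> X \<Longrightarrow> K s t = L s t" "x ` {..<m} \<subseteq> X"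
  shows "kernel_mat K m x = kernel_mat L m x"
  using assms by (auto simp: kernel_mat_def intro!: cong_mat)

lemma lebesgue_constant_cong:
  assumes "\<And>s t. s \<in> X \<Longrightarrow> t \<in> X \<Longrightarrow> K s t = L s t" "x ` {..<m} \<subseteq> X"
  shows "lebesgue_constant X K m x = lebesgue_constant X L m x"
proof -
  have "kernel_vec K m x t = kernel_vec L m x t" if "t \<in> X" for t
    using assms that by (auto simp: kernel_vec_def image_subset_iff intro!: eq_vecI)
  moreover have "kernel_mat K m x = kernel_mat L m x"
    using assms by (rule kernel_mat_cong)
  ultimately show ?thesis
    unfolding lebesgue_constant_def by simp
qed

lemma admissible_kernel_cong:
  assumes "\<And>s t. s \<in> X \<Longrightarrow> t \<in> X \<Longrightarrow> K s t = L s t"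
  shows "admissible_kernel X K \<longleftrightarrow> admissible_kernel X L"
proof -
  have "kernel_mat K m x = kernel_mat L m x" if "distinct_points X m x" for m x
    using that kernel_mat_cong[OF assms] by (auto simp: distinct_points_def)
  moreover have "K (x j) t = L (x j) t" if "range x \<subseteq> X" "t \<in> X" for x :: "nat \<Rightarrow> _" and j t
    using that by (intro assms) auto
  ultimately show ?thesis
    unfolding admissible_kernel_def by (simp add: assms cong: imp_cong)
qed

theorem theorem4p3:
  fixes X :: "real set" and K :: "real \<Rightarrow> real \<Rightarrow> real"
  assumes X: "X = {0<..<1}"
    and K: "\<And>x y. x \<in> X \<Longrightarrow> y \<in> X \<Longrightarrow> K x y = min x y"
  shows "admissible_kernel X K \<and>
         (\<forall>m\<ge>1. \<forall>x. distinct_points X m x \<longrightarrow> lebesgue_constant X K m x \<le> 1)"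
proof (intro conjI allI impI)
  show "admissible_kernel X K"
    using admissible_kernel_cong[of X K min, OF K] admissible_kernel_min by (simp add: X)
  fix m x
  assume mx: "m \<ge> 1" "distinct_points X m x"
  then have "lebesgue_constant X K m x = lebesgue_constant X min m x"
    by (intro lebesgue_constant_cong K) (auto simp: distinct_points_def)
  then show "lebesgue_constant X K m x \<le> 1"
    using lebesgue_constant_min_le_1[of m x] mx by (simp add: X)
qed

end
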